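(* Let $\Omega^h\subset\Omega$ and $\Gamma^h\subset\Gamma$ be fixed finite sets such that $Z^h:=\Omega^h\cup\Gamma^h\neq\emptyset$. Let $H\subset\overline{\mathcal H}$ be a class of depth-$L$ neural networks satisfying one of the following assumptions: (i) $H=\overline{\mathcal H}_{\mathrm{sm},1}(Z^h)$ consists of ReLU neural networks (activation $\sigma(x)=\max\{0,x\}$) with $L\ge\lceil\log_2(d+1)\rceil+1$. (ii) $H=\overline{\mathcal H}_{\mathrm{sm},\ell}(Z^h)$, where $\ell:=2|\Omega^h|+|\Gamma^h|$, consists of neural networks with activation $\sigma\in C^{\ell}(\mathbb R)$ such that there exists $s\in\mathbb R$ with $D^k\sigma(s)\neq 0$ for all $0\le k\le\ell$, and depth $L\ge 2$. If $L>2$, it is additionally assumed that $\sigma$ is strictly monotone. If the minimization problem $\operatorname{argmin}_{u_\theta\in H}\mathcal J_{\mathrm{DR}}^h(u_\theta)$ admits a solution, then the set of minimizers is infinite.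
   Context: Let $d\in\mathbb N$, let $\Omega\subset\mathbb R^d$ be a bounded open domain with Lipschitz boundary $\partial\Omega$, and let $\Gamma\subseteq\partial\Omega$ be measurable. $|A|$ denotes the cardinality of a finite set $A$. Neural networks. For a fixed activation $\sigma:\mathbb R\to\mathbb R$ and depth $L\in\mathbb N$, $\mathcal N_L$ is the set of all functions $f:\mathbb R^d\to\mathbb R$ of the form $\varphi_0(x)=x$, $\varphi_i(x)=\sigma(W_i\varphi_{i-1}(x)+b_i)$ for $i=1,\dots,L-1$ ($\sigma$ applied componentwise), $f(x)=W_L\varphi_{L-1}(x)+b_L$, with $W_i\in\mathbb R^{d_i\times d_{i-1}}$, $b_i\in\mathbb R^{d_i}$, $d_0=d$, $d_L=1$, and arbitrary hidden widths $d_1,\dots,d_{L-1}\in\mathbb N$. Set $\overline{\mathcal H}:=\{f|_{\overline\Omega}: f\in\mathcal N_L\}$. For $r\in\mathbb N_0$, $\overline{\mathcal H}_{\mathrm{sm},r}(Z^h)$ is the set of those elements $f|_{\overline\Omega}$ of $\overline{\mathcal H}$ for which the network $f$ is $C^r$ at every $z\in Z^h$ (that is, $r$ times continuously differentiable in a neighbourhood of each $z\in Z^h$). Elements are regarded as functions (not as parameter vectors), so "the set of minimizers is infinite" means infinitely many distinct functions. Discrete Deep Ritz loss. Let $\mathcal L:\mathbb R^d\times\mathbb R\times\Omega\to\mathbb R$ be a local integrand, $p\in[1,\infty)$, $\alpha_{\mathcal B}\ge 0$, let $\omega_{\mathcal L}^z$ ($z\in\Omega^h$) and $\omega_{\mathcal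 B}^z$ ($z\in\Gamma^h$) be real quadrature weights, and let $\mathcal B$ be a boundary operator of order $0$ encoding Dirichlet-type conditions, i.e. $\mathcal B(\mathrm{Tr}(u)(z))\in\mathbb R$ is a given function of the boundary value of $u$ at $z$ (possibly depending on $z$). Then $$\mathcal J_{\mathrm{DR}}^h(u):=\sum_{z\in\Omega^h}\omega_{\mathcal L}^z\,\mathcal L(\nabla u(z),u(z),z)+\alpha_{\mathcal B}\sum_{z\in\Gamma^h}\omega_{\mathcal B}^z\,|\mathcal B(\mathrm{Tr}(u)(z))|^p ,$$ where for $z\in\Gamma^h$ the term $\mathrm{Tr}(u)(z)$ is the classical point value $u(z)$, and $\nabla u(z)$ is the classical pointwise gradient. *)

theory Defs
  imports "HOL-Analysis.Analysis"
begin

text \<open>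
  Near each boundary point the set is, in suitable rotated coordinates, the strict epigraph of a
  Lipschitz function. Instead of rotating, we split \<open>y\<close> into its component \<open>y \<bullet> \<nu>\<close> along a unit
  vector \<open>\<nu>\<close> and its projection onto the hyperplane orthogonal to \<open>\<nu>\<close>, which plays the role of
  \<open>\<real>\<^bsup>d-1\<^esup>\<close>.
\<close>

definition lipschitz_boundary :: "'a::euclidean_space set \<Rightarrow> bool" where
  "lipschitz_boundary \<Omega> \<longleftrightarrow>
     (\<forall>x\<in>frontier \<Omega>. \<exists>r>0. \<exists>\<nu> C. \<exists>\<gamma> :: 'a \<Rightarrow> real.
        norm \<nu> = 1 \<and> C-lipschitz_on {w. w \<bullet> \<nu> = 0} \<gamma> \<and>
        \<Omega> \<inter> ball x r = {y \<in> ball x r. y \<bullet> \<nu> > \<gamma> (y - (y \<bullet> \<nu>) *\<^sub>R \<nu>)})"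

definition bounded_lipschitz_domain :: "'a::euclidean_space set \<Rightarrow> bool" where
  "bounded_lipschitz_domain \<Omega> \<longleftrightarrow>
     open \<Omega> \<and> connected \<Omega> \<and> \<Omega> \<noteq> {} \<and> bounded \<Omega> \<and> lipschitz_boundary \<Omega>"

text \<open>
  The \<open>s\<close>-dimensional Hausdorff outer measure, without the normalising constant, which does not
  affect measurability. Empty covering sets must count 0 also for \<open>s = 0\<close>, where \<open>0 ^ 0 = 1\<close>;
  boundedness is required because the library's diameter is meaningless on unbounded sets.
\<close>

definition hausdorff_outer_measure :: "nat \<Rightarrow> 'a::metric_space set \<Rightarrow> ennreal" where
  "hausdorff_outer_measure s A =
     (SUP \<delta>\<in>{0::real<..}.
        INF C\<in>{C :: nat \<Rightarrow> 'a set. A \<subseteq> (\<Union>i. C i) \<and> (\<forall>i. bounded (C i) \<and> diameter (C i) \<le> \<delta>)}.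
          \<Sum>i. if C i = {} then 0 else ennreal (diameter (C i) ^ s))"

text \<open>
  Measurability with respect to the surface measure, i.e. Caratheodory measurability for the
  \<open>(d-1)\<close>-dimensional Hausdorff outer measure. (Lebesgue measurability would be vacuous here,
  as Lipschitz boundaries are Lebesgue null sets.)
\<close>

definition surface_measurable :: "'a::euclidean_space set \<Rightarrow> bool" where
  "surface_measurable \<Gamma> \<longleftrightarrow>
     \<Gamma> \<in> lambda_system UNIV (Pow UNIV) (hausdorff_outer_measure (DIM('a) - 1))"

text \<open>Meant for open \<open>S\<close>, since the derivatives are two-sided ones in the whole space.\<close>

primrec Ck_on :: "nat \<Rightarrow> ('a::real_normed_vector \<Rightarrow> 'b::real_normed_vector) \<Rightarrow> 'a set \<Rightarrow> bool" where
  "Ck_on 0 f S \<longleftrightarrow> continuous_on S f"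
| "Ck_on (Suc k) f S \<longleftrightarrow>
     (\<forall>x\<in>S. f differentiable (at x)) \<and>
     (\<forall>v. Ck_on k (\<lambda>x. frechet_derivative f (at x) v) S)"

definition Ck_at :: "nat \<Rightarrow> ('a::real_normed_vector \<Rightarrow> 'b::real_normed_vector) \<Rightarrow> 'a \<Rightarrow> bool" where
  "Ck_at k f z \<longleftrightarrow> (\<exists>U. open U \<and> z \<in> U \<and> Ck_on k f U)"

definition gradient :: "('a::real_inner \<Rightarrow> real) \<Rightarrow> 'a \<Rightarrow> 'a" where
  "gradient u z = (THE D. GDERIV u z :> D)"

definition relu :: "real \<Rightarrow> real" where
  "relu x = max 0 x"

text \<open>
  Vectors and matrices of varying size are functions on natural numbers, of which only the entries
  with indices below the widths \<open>n i\<close> matter. \<open>W i j k\<close> and \<open>b i j\<close> are the entries of the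
  weights \<open>W\<^sub>i\<close> and biases \<open>b\<^sub>i\<close> of layer \<open>i\<close>, with \<open>j\<close> and \<open>k\<close> counted from 0. The finite index type \<open>'d\<close> is
  enumerated by \<^const>\<open>from_nat_into\<close> to get the coordinates of the input; the resulting set of
  networks does not depend on the enumeration.
\<close>

primrec nn_layer ::
  "(real \<Rightarrow> real) \<Rightarrow> (nat \<Rightarrow> nat) \<Rightarrow> (nat \<Rightarrow> nat \<Rightarrow> nat \<Rightarrow> real) \<Rightarrow> (nat \<Rightarrow> nat \<Rightarrow> real) \<Rightarrow>
   nat \<Rightarrow> real ^ 'd::finite \<Rightarrow> nat \<Rightarrow> real" where
  "nn_layer \<sigma> n W b 0 x = (\<lambda>j. x $ from_nat_into UNIV j)"
| "nn_layer \<sigma> n W b (Suc i) x =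
     (\<lambda>j. \<sigma> ((\<Sum>k<n i. W (Suc i) j k * nn_layer \<sigma> n W b i x k) + b (Suc i) j))"

definition nn_fun ::
  "(real \<Rightarrow> real) \<Rightarrow> nat \<Rightarrow> (nat \<Rightarrow> nat) \<Rightarrow> (nat \<Rightarrow> nat \<Rightarrow> nat \<Rightarrow> real) \<Rightarrow> (nat \<Rightarrow> nat \<Rightarrow> real) \<Rightarrow>
   real ^ 'd::finite \<Rightarrow> real" where
  "nn_fun \<sigma> L n W b x = (\<Sum>k<n (L - 1). W L 0 k * nn_layer \<sigma> n W b (L - 1) x k) + b L 0"

definition networks :: "(real \<Rightarrow> real) \<Rightarrow> nat \<Rightarrow> (real ^ 'd::finite \<Rightarrow> real) set" where
  "networks \<sigma> L =
     {nn_fun \<sigma> L n W b | n W b. n 0 = CARD('d) \<and> n L = 1 \<and> (\<forall>i\<in>{0<..<L}. 1 \<le> n i)}"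

text \<open>
  Smoothness at boundary points is that of the network on the whole space. Since \<^const>\<open>restrict\<close>
  fixes the values outside \<open>closure \<Omega>\<close>, two members are equal iff they agree on \<open>closure \<Omega>\<close>.
\<close>

definition network_class_sm ::
  "(real \<Rightarrow> real) \<Rightarrow> nat \<Rightarrow> (real ^ 'd::finite) set \<Rightarrow> nat \<Rightarrow> (real ^ 'd) set \<Rightarrow>
   (real ^ 'd \<Rightarrow> real) set" where
  "network_class_sm \<sigma> L \<Omega> r Z =
     {restrict f (closure \<Omega>) | f. f \<in> networks \<sigma> L \<and> (\<forall>z\<in>Z. Ck_at r f z)}"

text \<open>
  \<open>\<B> z\<close> is the zeroth-order boundary operator at \<open>z\<close>, applied to the trace \<open>u z\<close>. Only the values
  of the integrand \<open>\<L>\<close> at points of \<open>\<Omega>h\<close> enter, so a total \<open>\<L>\<close> is no restriction.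
\<close>

definition deep_ritz_loss ::
  "(real ^ 'd::finite \<Rightarrow> real \<Rightarrow> real ^ 'd \<Rightarrow> real) \<Rightarrow> (real ^ 'd \<Rightarrow> real \<Rightarrow> real) \<Rightarrow>
   real \<Rightarrow> real \<Rightarrow> (real ^ 'd \<Rightarrow> real) \<Rightarrow> (real ^ 'd \<Rightarrow> real) \<Rightarrow>
   (real ^ 'd) set \<Rightarrow> (real ^ 'd) set \<Rightarrow> (real ^ 'd \<Rightarrow> real) \<Rightarrow> real" where
  "deep_ritz_loss \<L> \<B> p \<alpha> \<omega>\<^sub>L \<omega>\<^sub>B \<Omega>h \<Gamma>h u =
     (\<Sum>z\<in>\<Omega>h. \<omega>\<^sub>L z * \<L> (gradient u z) (u z) z)
       + \<alpha> * (\<Sum>z\<in>\<Gamma>h. \<omega>\<^sub>B z * \<bar>\<B> z (u z)\<bar> powr p)"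

end

theory Submission
  imports Defs
begin

text \<open>
  The loss sees a network only through finitely many numbers: its values on \<open>\<Omega>h \<union> \<Gamma>h\<close> and its
  gradients on \<open>\<Omega>h\<close>. Networks of a fixed depth \<open>L \<ge> 2\<close> form a vector space, because two networks can
  be run side by side. So it suffices to find a single network \<open>v\<close> of depth \<open>L\<close> that is smooth at the
  sample points, has value 0 there and gradient 0 on \<open>\<Omega>h\<close>, but does not vanish on \<open>\<Omega>\<close>: if \<open>u\<close> is a
  minimizer then so are the pairwise distinct functions \<open>u + t v\<close>, for all real \<open>t\<close>. This is
  \<open>infinite_minimizers_if_undetected_network\<close>.

  In both cases \<open>v\<close> is a function of one coordinate of the input only. The layers before the last
  hidden one have width 1 and carry that coordinate through as a number \<open>\<rho> x\<close>, and \<open>v x\<close> is a sum of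
  terms \<open>c \<sigma> (w \<rho> x + a)\<close> (\<open>ridge_network\<close>).

  For ReLU networks, biases that are large compared with the domain make all activations in the
  narrow layers act as the identity, and three ReLUs in the last hidden layer give a hat function.
  Its support is chosen narrow enough to avoid the coordinates of all sample points, so \<open>v\<close> even
  vanishes near them (\<open>undetected_relu_network\<close>).

  In the smooth case \<open>v = g \<circ> \<rho>\<close> with \<open>\<rho>\<close> an iterate of \<open>\<sigma>\<close>, which is injective because \<open>\<sigma>\<close> is strictly
  monotone, and \<open>g t\<close> a sum of terms \<open>c \<sigma> (w t + s)\<close>. On \<open>g\<close> there are at most \<open>l\<close> linear
  conditions, \<open>g = 0\<close> at the points \<open>\<rho> z\<close> for all samples \<open>z\<close> and \<open>g' = 0\<close> at those for \<open>z \<in> \<Omega>h\<close>. If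
  every \<open>g\<close> that satisfies them vanished at \<open>l + 1\<close> further points \<open>\<tau>\<close> of the range of \<open>\<rho>\<close>, each
  of the \<open>l + 1\<close> functions \<open>w \<mapsto> \<sigma> (w \<tau> + s)\<close> would be a linear combination of the same \<open>l\<close>
  functions, and there would be a relation \<open>\<Sum> y\<^sub>\<tau> \<sigma> (w \<tau> + s) = 0\<close> for all \<open>w\<close>. Differentiating it \<open>k \<le> l\<close>
  times at \<open>w = 0\<close> and dividing by the \<open>k\<close>-th derivative of \<open>\<sigma>\<close> at \<open>s\<close> gives \<open>\<Sum> y\<^sub>\<tau> \<tau>\<^sup>k = 0\<close>, a
  Vandermonde system whose only solution is \<open>y = 0\<close>. The two halves of this argument are
  \<open>separating_weighted_eval\<close> and \<open>dilates_independent\<close>.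
\<close>

section \<open>Functions of class \<open>C\<^sup>k\<close>\<close>

lemma Ck_on_subset: "Ck_on k f S \<Longrightarrow> T \<subseteq> S \<Longrightarrow> Ck_on k f T"
  by (induction k arbitrary: f) (auto intro: continuous_on_subset)

lemma frechet_derivative_cong_open:
  assumes "open S" "x \<in> S" "\<And>y. y \<in> S \<Longrightarrow> f y = g y"
  shows "f differentiable (at x) \<longleftrightarrow> g differentiable (at x)"
    and "frechet_derivative f (at x) = frechet_derivative g (at x)"
proof -
  have "(f has_derivative D) (at x) \<longleftrightarrow> (g has_derivative D) (at x)" for D
    using assms has_derivative_transform_within_open[of f D x UNIV S g]
      has_derivative_transform_within_open[of g D x UNIV S f] by auto
  then show "f differentiable (at x) \<longleftrightarrow> g differentiable (at x)"
    and "frechet_derivative f (at x) = frechet_derivative g (at x)"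
    unfolding differentiable_def frechet_derivative_def by simp_all
qed

lemma Ck_on_cong:
  assumes "open S" "\<And>y. y \<in> S \<Longrightarrow> f y = g y"
  shows "Ck_on k f S \<longleftrightarrow> Ck_on k g S"
  using assms(2)
proof (induction k arbitrary: f g)
  case 0
  then show ?case by (simp cong: continuous_on_cong)
next
  case (Suc k)
  note eq = frechet_derivative_cong_open[OF assms(1) _ Suc.prems]
  have "Ck_on k (\<lambda>x. frechet_derivative f (at x) v) S
      \<longleftrightarrow> Ck_on k (\<lambda>x. frechet_derivative g (at x) v) S" for v
    by (rule Suc.IH) (simp add: eq(2))
  then show ?case using eq(1) by simp
qed

text \<open>
  The derivative prescribed by \<^const>\<open>Ck_on\<close> is the chosen one \<^const>\<open>frechet_derivative\<close>. This rule
  accepts any formula for the derivative instead, which is what makes the sum, product and chain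
  rules provable by induction on the order.
\<close>

lemma Ck_on_SucI:
  assumes "open S" "\<And>x. x \<in> S \<Longrightarrow> (f has_derivative D x) (at x)"
    and "\<And>v. Ck_on k (\<lambda>x. D x v) S"
  shows "Ck_on (Suc k) f S"
proof -
  have "Ck_on k (\<lambda>x. frechet_derivative f (at x) v) S" for v
    using assms(3)[of v] Ck_on_cong[OF assms(1), of "\<lambda>x. frechet_derivative f (at x) v" "\<lambda>x. D x v" k]
      frechet_derivative_at[OF assms(2)] by fastforce
  moreover have "f differentiable (at x)" if "x \<in> S" for x
    using assms(2)[OF that] by (auto simp: differentiable_def)
  ultimately show ?thesis by simp
qed

lemma Ck_on_Suc_D:
  assumes "Ck_on (Suc k) f S" "x \<in> S"
  shows "(f has_derivative frechet_derivative f (at x)) (at x)"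
  using assms frechet_derivative_works by auto

lemma Ck_on_le: "Ck_on k f S \<Longrightarrow> j \<le> k \<Longrightarrow> Ck_on j f S"
proof (induction k arbitrary: f j)
  case (Suc k)
  show ?case
  proof (cases j)
    case 0
    then show ?thesis using Suc.prems
      by (auto intro!: continuous_at_imp_continuous_on differentiable_imp_continuous_within)
  next
    case (Suc i)
    then show ?thesis using Suc.prems Suc.IH by auto
  qed
qed auto

lemma Ck_on_const: "Ck_on k (\<lambda>x. c) S"
  by (induction k arbitrary: c) auto

lemma Ck_on_bounded_linear: 
  assumes "bounded_linear f" shows "Ck_on k f S"
proof (cases k)
  case 0
  then show ?thesis using assms by (simp add: linear_continuous_on)
next
  case (Suc k)
  have "(f has_derivative f) (at x)" for x
    using assms by (rule bounded_linear_imp_has_derivative)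
  then have "f differentiable (at x)" "frechet_derivative f (at x) = f" for x
    using frechet_derivative_at[of f f x] by (auto simp: differentiable_def)
  then show ?thesis using Suc by (simp add: Ck_on_const)
qed

lemma Ck_on_add:
  assumes "open S" "Ck_on k f S" "Ck_on k g S"
  shows "Ck_on k (\<lambda>x. f x + g x) S"
  using assms(2,3)
proof (induction k arbitrary: f g)
  case 0
  then show ?case by (simp add: continuous_on_add)
next
  case (Suc k)
  show ?case
  proof (rule Ck_on_SucI[OF assms(1)])
    show "((\<lambda>x. f x + g x) has_derivative
            (\<lambda>v. frechet_derivative f (at x) v + frechet_derivative g (at x) v)) (at x)"
      if "x \<in> S" for x
      using Suc.prems that by (intro has_derivative_add Ck_on_Suc_D)
    show "Ck_on k (\<lambda>x. frechet_derivative f (at x) v + frechet_derivative g (at x) v) S" for v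
      by (rule Suc.IH) (use Suc.prems in auto)
  qed
qed

text \<open>
  By the product rule the derivative again consists of products, whose factors include the functions
  themselves; these are one order smoother than the induction hypothesis asks for.
\<close>

lemma Ck_on_mult:
  fixes f g :: "'a::real_normed_vector \<Rightarrow> real"
  assumes "open S" "Ck_on k f S" "Ck_on k g S"
  shows "Ck_on k (\<lambda>x. f x * g x) S"
  using assms(2,3)
proof (induction k arbitrary: f g)
  case 0
  then show ?case by (simp add: continuous_on_mult)
next
  case (Suc k)
  have lower: "Ck_on k f S" "Ck_on k g S"
    using Suc.prems by (auto intro: Ck_on_le[of "Suc k"])
  show ?case
  proof (rule Ck_on_SucI[OF assms(1)])
    show "((\<lambda>x. f x * g x) has_derivative
            (\<lambda>v. f x * frechet_derivative g (at x) v + frechet_derivative f (at x) v * g x)) (at x)"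
      if "x \<in> S" for x
      using Suc.prems that by (intro has_derivative_mult Ck_on_Suc_D)
    show "Ck_on k (\<lambda>x. f x * frechet_derivative g (at x) v + frechet_derivative f (at x) v * g x) S"
      for v
    proof (rule Ck_on_add[OF assms(1)])
      show "Ck_on k (\<lambda>x. f x * frechet_derivative g (at x) v) S"
        by (rule Suc.IH) (use Suc.prems lower in auto)
      show "Ck_on k (\<lambda>x. frechet_derivative f (at x) v * g x) S"
        by (rule Suc.IH) (use Suc.prems lower in auto)
    qed
  qed
qed

lemma Ck_on_Suc_real:
  fixes f :: "real \<Rightarrow> real"
  assumes "Ck_on (Suc k) f UNIV"
  shows "(f has_real_derivative deriv f x) (at x)" and "Ck_on k (deriv f) UNIV"
proof -
  have D: "(f has_real_derivative deriv f x) (at x)" for x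
    using assms by (auto simp: DERIV_deriv_iff_real_differentiable)
  then show "(f has_real_derivative deriv f x) (at x)" .
  have "frechet_derivative f (at x) 1 = deriv f x" for x
    using frechet_derivative_at[OF D[of x, unfolded has_field_derivative_def]] by (metis mult_1_right)
  moreover have "Ck_on k (\<lambda>x. frechet_derivative f (at x) 1) UNIV"
    using assms by simp
  ultimately show "Ck_on k (deriv f) UNIV" by (simp add: eta_contract_eq)
qed

text \<open>
  By the chain rule the derivative is a product of \<open>deriv f \<circ> g\<close>, to which the induction hypothesis
  applies, with a derivative of \<open>g\<close>.
\<close>

lemma Ck_on_compose_real:
  fixes f :: "real \<Rightarrow> real" and g :: "'a::real_normed_vector \<Rightarrow> real"
  assumes "open S" "Ck_on k f UNIV" "Ck_on k g S"
  shows "Ck_on k (\<lambda>x. f (g x)) S"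
  using assms(2,3)
proof (induction k arbitrary: f g)
  case 0
  then show ?case by (auto intro: continuous_on_compose2)
next
  case (Suc k)
  show ?case
  proof (rule Ck_on_SucI[OF assms(1)])
    show "((\<lambda>x. f (g x)) has_derivative (\<lambda>v. deriv f (g x) * frechet_derivative g (at x) v)) (at x)"
      if "x \<in> S" for x
      using Ck_on_Suc_real(1)[OF Suc.prems(1), unfolded has_field_derivative_def]
        Ck_on_Suc_D[OF Suc.prems(2) that] by (rule has_derivative_compose[rotated])
    show "Ck_on k (\<lambda>x. deriv f (g x) * frechet_derivative g (at x) v) S" for v
    proof (rule Ck_on_mult[OF assms(1)])
      show "Ck_on k (\<lambda>x. deriv f (g x)) S"
        using Suc.IH[OF Ck_on_Suc_real(2)[OF Suc.prems(1)] Ck_on_le[OF Suc.prems(2)]] by simp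
      show "Ck_on k (\<lambda>x. frechet_derivative g (at x) v) S"
        using Suc.prems by simp
    qed
  qed
qed

lemma Ck_on_sum:
  fixes f :: "'i \<Rightarrow> 'a::real_normed_vector \<Rightarrow> real"
  assumes "open S" "\<And>i. i \<in> I \<Longrightarrow> Ck_on k (f i) S"
  shows "Ck_on k (\<lambda>x. \<Sum>i\<in>I. f i x) S"
  using assms(2)
  by (induction I rule: infinite_finite_induct) (auto simp: Ck_on_const intro!: Ck_on_add[OF assms(1)])

lemma Ck_on_iterated_deriv:
  fixes \<sigma> :: "real \<Rightarrow> real"
  assumes "Ck_on l \<sigma> UNIV" "k \<le> l"
  shows "Ck_on (l - k) ((deriv ^^ k) \<sigma>) UNIV"
  using assms(2)
proof (induction k)
  case (Suc k)
  then have "l - k = Suc (l - Suc k)" by simp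
  then show ?case using Suc Ck_on_Suc_real(2)[of "l - Suc k" "(deriv ^^ k) \<sigma>"] by simp
qed (use assms in auto)

lemma Ck_at_add: 
  assumes "Ck_at k f z" "Ck_at k g z"
  shows "Ck_at k (\<lambda>x. f x + g x) z"
proof -
  obtain U V where U: "open U" "z \<in> U" "Ck_on k f U" and V: "open V" "z \<in> V" "Ck_on k g V"
    using assms by (auto simp: Ck_at_def)
  have "Ck_on k (\<lambda>x. f x + g x) (U \<inter> V)"
    using U V by (intro Ck_on_add open_Int) (auto elim: Ck_on_subset)
  then show ?thesis unfolding Ck_at_def using U V by blast
qed

lemma Ck_at_cmult: 
  fixes f :: "'a::real_normed_vector \<Rightarrow> real"
  assumes "Ck_at k f z"
  shows "Ck_at k (\<lambda>x. t * f x) z"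
proof -
  obtain U where "open U" "z \<in> U" "Ck_on k f U" using assms by (auto simp: Ck_at_def)
  then show ?thesis unfolding Ck_at_def using Ck_on_mult[OF _ Ck_on_const[of k t U], of f] by blast
qed

lemma Ck_at_locally_zero:
  assumes "open U" "z \<in> U" "\<And>x. x \<in> U \<Longrightarrow> f x = 0"
  shows "Ck_at k f z"
  unfolding Ck_at_def using assms Ck_on_cong[of U f "\<lambda>x. 0" k] Ck_on_const[of k 0 U] by blast

section \<open>Networks of a fixed depth\<close>

lemma nn_layer_Ck_on:
  assumes "Ck_on k \<sigma> UNIV"
  shows "Ck_on k (\<lambda>x::real^'d::finite. nn_layer \<sigma> n W b i x j) UNIV"
proof (induction i arbitrary: j)
  case 0
  then show ?case by (simp add: Ck_on_bounded_linear bounded_linear_vec_nth)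
next
  case (Suc i)
  have "Ck_on k (\<lambda>x::real^'d. (\<Sum>m<n i. W (Suc i) j m * nn_layer \<sigma> n W b i x m) + b (Suc i) j) UNIV"
    by (rule Ck_on_add Ck_on_sum Ck_on_mult Ck_on_const open_UNIV Suc.IH)+
  from Ck_on_compose_real[OF open_UNIV assms this] show ?case by simp
qed

lemma networks_Ck_on:
  assumes "Ck_on k \<sigma> UNIV" "f \<in> networks \<sigma> L"
  shows "Ck_on k f UNIV"
proof -
  obtain n W b where f: "f = nn_fun \<sigma> L n W b"
    using assms(2) by (auto simp: networks_def)
  show ?thesis unfolding f nn_fun_def
    by (rule Ck_on_add Ck_on_sum Ck_on_mult Ck_on_const open_UNIV nn_layer_Ck_on[OF assms(1)])+
qed

text \<open>
  The two networks are run side by side: the width of each hidden layer is the sum of the two widths,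
  and the weight matrices are block diagonal, except that both blocks of the first layer read the
  same input and the output layer adds the two results. This needs a hidden layer, hence \<open>L \<ge> 2\<close>.
\<close>

lemma networks_add_cmult:
  fixes f g :: "real^'d::finite \<Rightarrow> real"
  assumes "f \<in> networks \<sigma> L" "g \<in> networks \<sigma> L" "2 \<le> L"
  shows "(\<lambda>x. f x + t * g x) \<in> networks \<sigma> L"
proof -
  obtain n1 W1 b1 where f: "f = nn_fun \<sigma> L n1 W1 b1" 
      and n1: "n1 0 = CARD('d)" "n1 L = 1" "\<forall>i\<in>{0<..<L}. 1 \<le> n1 i"
    using assms(1) by (auto simp: networks_def)
  obtain n2 W2 b2 where g: "g = nn_fun \<sigma> L n2 W2 b2" 
      and n2: "n2 0 = CARD('d)" "n2 L = 1" "\<forall>i\<in>{0<..<L}. 1 \<le> n2 i"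
    using assms(2) by (auto simp: networks_def)
  define n where "n i = (if i = 0 then CARD('d) else if i = L then 1 else n1 i + n2 i)" for i
  define W where "W i j k =
     (if i = L then if k < n1 (L - 1) then W1 L 0 k else t * W2 L 0 (k - n1 (L - 1))
      else if j < n1 i then if i = 1 \<or> k < n1 (i - 1) then W1 i j k else 0
      else if i = 1 then W2 i (j - n1 i) k
      else if k < n1 (i - 1) then 0 else W2 i (j - n1 i) (k - n1 (i - 1)))" for i j k
  define b where "b i j = (if i = L then b1 L 0 + t * b2 L 0
      else if j < n1 i then b1 i j else b2 i (j - n1 i))" for i j
  have split: "(\<Sum>k<a+c. h k) = (\<Sum>k<a. h k) + (\<Sum>k<c. h (a + k))" for a c and h :: "nat \<Rightarrow> real"
    by (induction c) auto
  have layer: "(\<forall>j<n1 i. nn_layer \<sigma> n W b i x j = nn_layer \<sigma> n1 W1 b1 i x j) \<and>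
      (\<forall>j<n2 i. nn_layer \<sigma> n W b i x (n1 i + j) = nn_layer \<sigma> n2 W2 b2 i x j)"
    if "0 < i" "i < L" for i and x :: "real^'d"
    using that
  proof (induction i)
    case (Suc i)
    show ?case
    proof (cases "i = 0")
      case True
      then show ?thesis using Suc.prems n1 n2 by (auto simp: n_def W_def b_def)
    next
      case False
      then have IH: "nn_layer \<sigma> n W b i x j = nn_layer \<sigma> n1 W1 b1 i x j" if "j < n1 i" for j
        using Suc False that by auto
      from False have IH2: "nn_layer \<sigma> n W b i x (n1 i + j) = nn_layer \<sigma> n2 W2 b2 i x j" if "j < n2 i" for j
        using Suc False that by auto
      have n: "n i = n1 i + n2 i" using False Suc.prems by (simp add: n_def)
      have b: "b (Suc i) j = b1 (Suc i) j" if "j < n1 (Suc i)" for j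
        using that Suc.prems by (simp add: b_def)
      have b2: "b (Suc i) (n1 (Suc i) + j) = b2 (Suc i) j" for j
        using Suc.prems by (simp add: b_def)
      have W1: "W (Suc i) j k = (if k < n1 i then W1 (Suc i) j k else 0)" if "j < n1 (Suc i)" for j k
        using that False Suc.prems by (simp add: W_def)
      have W2: "W (Suc i) (n1 (Suc i) + j) k = (if k < n1 i then 0 else W2 (Suc i) j (k - n1 i))" for j k
        using False Suc.prems by (simp add: W_def)
      show ?thesis by (simp add: n split IH IH2 b b2 W1 W2)
    qed
  qed auto
  have "nn_fun \<sigma> L n W b x = f x + t * g x" for x
  proof -
    have "n (L - 1) = n1 (L - 1) + n2 (L - 1)" using assms(3) by (auto simp: n_def)
    moreover have "b L 0 = b1 L 0 + t * b2 L 0" by (simp add: b_def)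
    moreover have "W L 0 k = (if k < n1 (L - 1) then W1 L 0 k else t * W2 L 0 (k - n1 (L - 1)))" for k
      by (simp add: W_def)
    ultimately show ?thesis using layer[of "L - 1" x] assms(3)
      by (simp add: f g nn_fun_def split algebra_simps sum_distrib_left)
  qed
  then have "(\<lambda>x. f x + t * g x) = nn_fun \<sigma> L n W b" by auto
  moreover have "n 0 = CARD('d)" "n L = 1" "\<forall>i\<in>{0<..<L}. 1 \<le> n i"
    using assms(3) n1 n2 by (auto simp: n_def)
  ultimately show ?thesis unfolding networks_def mem_Collect_eq
    by - (rule exI, rule exI, rule exI, intro conjI, assumption+)
qed

text \<open>
  Layers \<open>1, \<dots>, L - 2\<close> have width 1, weight 1 and bias \<open>\<beta>\<close>, so that they iterate \<open>y \<mapsto> \<sigma> (y + \<beta>)\<close> on one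
  coordinate of the input. Each triple \<open>(c, w, a)\<close> stands for one neuron of the last hidden layer, with
  incoming weight \<open>w\<close>, bias \<open>a\<close> and outgoing weight \<open>c\<close>. The bias \<open>\<beta>\<close> serves to keep the argument of
  a ReLU positive.
\<close>

lemma ridge_network:
  assumes "2 \<le> L" "xs \<noteq> []"
  shows "(\<lambda>x::real^'d::finite. \<Sum>(c, w, a)\<leftarrow>xs.
            c * \<sigma> (w * ((\<lambda>y. \<sigma> (y + \<beta>)) ^^ (L - 2)) (x $ from_nat_into UNIV 0) + a))
         \<in> networks \<sigma> L" (is "?v \<in> _")
proof -
  obtain m where L: "L = Suc (Suc m)"
    using assms(1) by (metis add_2_eq_Suc le_Suc_ex)
  define n where "n i = (if i = 0 then CARD('d) else if i = Suc m then length xs else 1)" for i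
  define W where "W i j k = (if i = L then fst (xs ! k)
      else if k > 0 then 0 else if i = Suc m then fst (snd (xs ! j)) else 1)" for i j k
  define b where "b i j = (if i = L then 0 else if i = Suc m then snd (snd (xs ! j)) else \<beta>)"
    for i and j :: nat
  have n: "0 < n i" for i using assms(2) by (simp add: n_def)
  have first: "(\<Sum>k<n i. (if 0 < k then 0 else u) * h k) = u * h 0" for i u and h :: "nat \<Rightarrow> real"
  proof -
    have "(\<Sum>k<n i. (if 0 < k then 0 else u) * h k) = (\<Sum>k<n i. if k = 0 then u * h 0 else 0)"
      by (rule sum.cong) auto
    then show ?thesis using n by simp
  qed
  have n_last: "n (Suc m) = length xs" by (simp add: n_def)
  have W_out: "W L 0 k = fst (xs ! k)" and b_out: "b L 0 = 0" for k
    by (simp_all add: W_def b_def)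
  have W_last: "W (Suc m) j k = (if 0 < k then 0 else fst (snd (xs ! j)))"
    and b_last: "b (Suc m) j = snd (snd (xs ! j))" for j k
    by (simp_all add: W_def b_def L)
  have W_inner: "W (Suc i) 0 k = (if 0 < k then 0 else 1)" and b_inner: "b (Suc i) 0 = \<beta>"
    if "i < m" for i k
    using that by (simp_all add: W_def b_def L)
  have layer: "nn_layer \<sigma> n W b i x 0 = ((\<lambda>y. \<sigma> (y + \<beta>)) ^^ i) (x $ from_nat_into UNIV 0)"
    if "i \<le> m" for i and x :: "real^'d"
    using that by (induction i) (simp_all add: W_inner b_inner first)
  have "nn_fun \<sigma> L n W b x = ?v x" for x
  proof -
    have "nn_fun \<sigma> L n W b x = (\<Sum>k<length xs. fst (xs ! k) *
        \<sigma> (fst (snd (xs ! k)) * nn_layer \<sigma> n W b m x 0 + snd (snd (xs ! k))))"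
      by (simp add: nn_fun_def L W_out[unfolded L] b_out[unfolded L] W_last b_last n_last first)
    moreover have "(\<Sum>(c, w, a)\<leftarrow>xs. c * \<sigma> (w * r + a)) =
        (\<Sum>k<length xs. fst (xs ! k) * \<sigma> (fst (snd (xs ! k)) * r + snd (snd (xs ! k))))" for r
      by (subst sum_list_sum_nth) (simp add: atLeast0LessThan case_prod_beta)
    moreover have "L - 2 = m" by (simp add: L)
    ultimately show ?thesis by (simp only: layer[OF order.refl])
  qed
  then have "?v = nn_fun \<sigma> L n W b" by auto
  moreover have "n 0 = CARD('d)" "n L = 1" "\<forall>i\<in>{0<..<L}. 1 \<le> n i"
    using n assms(2) by (auto simp: n_def L Suc_le_eq)
  ultimately show ?thesis unfolding networks_def mem_Collect_eq
    by - (rule exI, rule exI, rule exI, intro conjI, assumption+)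
qed

section \<open>Combinations of dilates of the activation under linear conditions\<close>

text \<open>
  These are the finitely supported functionals on functions. Representing them by lists, in which
  points may repeat, makes their sum an append and their multiples a map.
\<close>

definition weighted_eval :: "(real \<times> 'x) list \<Rightarrow> ('x \<Rightarrow> real) \<Rightarrow> real" where
  "weighted_eval xs f = (\<Sum>(c, x)\<leftarrow>xs. c * f x)"

lemma weighted_eval_append: 
  "weighted_eval (xs @ ys) f = weighted_eval xs f + weighted_eval ys f"
  by (simp add: weighted_eval_def)

lemma weighted_eval_scale:
  "weighted_eval (map (\<lambda>(c, x). (t * c, x)) xs) f = t * weighted_eval xs f"
  by (induction xs) (auto simp: weighted_eval_def algebra_simps)

lemma weighted_eval_diff_scale:
  "weighted_eval xs (\<lambda>x. f x - t * g x) = weighted_eval xs f - t * weighted_eval xs g"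
  by (induction xs) (auto simp: weighted_eval_def algebra_simps)

text \<open>
  A functional that vanishes on the intersection of the kernels of finitely many functionals is a
  combination of these; here \<open>\<Phi>\<close> and \<open>\<psi>\<close> act as functionals on the weighted evaluations. The
  induction splits off one \<open>\<phi>0\<close>: if some \<open>ys\<close> annihilates the rest of \<open>\<Phi>\<close> but not \<open>\<phi>0\<close>, then
  subtracting a multiple of \<open>\<phi>0\<close> from \<open>\<psi>\<close> makes the induction hypothesis applicable.
\<close>

lemma linear_combination_of_annihilated:
  assumes "finite \<Phi>"
    and "\<And>xs. (\<And>\<phi>. \<phi> \<in> \<Phi> \<Longrightarrow> weighted_eval xs \<phi> = 0) \<Longrightarrow> weighted_eval xs \<psi> = 0"
  shows "\<exists>B. \<forall>x. \<psi> x = (\<Sum>\<phi>\<in>\<Phi>. B \<phi> * \<phi> x)"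
  using assms
proof (induction \<Phi> arbitrary: \<psi> rule: finite_induct)
  case empty
  have "\<psi> x = 0" for x
    using empty[of "[(1, x)]"] by (simp add: weighted_eval_def)
  then show ?case by simp
next
  case (insert \<phi>0 \<Phi>)
  have upd: "(\<Sum>\<phi>\<in>insert \<phi>0 \<Phi>. (B(\<phi>0 := r)) \<phi> * \<phi> x) = r * \<phi>0 x + (\<Sum>\<phi>\<in>\<Phi>. B \<phi> * \<phi> x)"
    for B r x
  proof -
    have "(\<Sum>\<phi>\<in>\<Phi>. (B(\<phi>0 := r)) \<phi> * \<phi> x) = (\<Sum>\<phi>\<in>\<Phi>. B \<phi> * \<phi> x)"
      using insert.hyps by (intro sum.cong) auto
    then show ?thesis using insert.hyps by simp
  qed
  show ?case
  proof (cases "\<exists>ys. (\<forall>\<phi>\<in>\<Phi>. weighted_eval ys \<phi> = 0) \<and> weighted_eval ys \<phi>0 \<noteq> 0")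
    case False
    then obtain B where "\<And>x. \<psi> x = (\<Sum>\<phi>\<in>\<Phi>. B \<phi> * \<phi> x)"
      using insert.IH[of \<psi>] insert.prems by blast
    then have "\<forall>x. \<psi> x = (\<Sum>\<phi>\<in>insert \<phi>0 \<Phi>. (B(\<phi>0 := 0)) \<phi> * \<phi> x)"
      by (simp add: upd del: fun_upd_apply sum.insert)
    then show ?thesis by blast
  next
    case True
    then obtain ys where ys: "\<And>\<phi>. \<phi> \<in> \<Phi> \<Longrightarrow> weighted_eval ys \<phi> = 0" "weighted_eval ys \<phi>0 \<noteq> 0"
      by blast
    \<comment> \<open>The multiple \<open>r\<close> for which \<open>ys\<close> annihilates \<open>\<psi> - r \<phi>0\<close>.\<close>
    define r where "r = weighted_eval ys \<psi> / weighted_eval ys \<phi>0"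
    have "weighted_eval xs (\<lambda>x. \<psi> x - r * \<phi>0 x) = 0"
      if xs: "\<And>\<phi>. \<phi> \<in> \<Phi> \<Longrightarrow> weighted_eval xs \<phi> = 0" for xs
    proof -
      \<comment> \<open>Correcting \<open>xs\<close> by a multiple of \<open>ys\<close> so that \<open>\<phi>0\<close> is annihilated as well.\<close>
      define zs where
        "zs = xs @ map (\<lambda>(c, x). (- (weighted_eval xs \<phi>0 / weighted_eval ys \<phi>0) * c, x)) ys"
      have zs: "weighted_eval zs f =
          weighted_eval xs f - weighted_eval xs \<phi>0 / weighted_eval ys \<phi>0 * weighted_eval ys f" for f
        unfolding zs_def weighted_eval_append weighted_eval_scale by simp
      have "weighted_eval zs \<phi> = 0" if "\<phi> \<in> insert \<phi>0 \<Phi>" for \<phi>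
        using that xs ys by (auto simp: zs)
      then have "weighted_eval zs \<psi> = 0" by (rule insert.prems)
      then show ?thesis unfolding zs weighted_eval_diff_scale r_def by simp
    qed
    from insert.IH[OF this] obtain B where B: "\<And>x. \<psi> x - r * \<phi>0 x = (\<Sum>\<phi>\<in>\<Phi>. B \<phi> * \<phi> x)"
      by blast
    have "\<forall>x. \<psi> x = (\<Sum>\<phi>\<in>insert \<phi>0 \<Phi>. (B(\<phi>0 := r)) \<phi> * \<phi> x)"
      by (simp add: upd B[symmetric] del: fun_upd_apply sum.insert)
    then show ?thesis by blast
  qed
qed

text \<open>
  Gaussian elimination: an equation \<open>\<phi>0\<close> that involves the unknown \<open>k0\<close> is solved for it and
  substituted into the others, which removes one equation and one unknown.
\<close>

lemma underdetermined_system: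
  fixes B :: "'k \<Rightarrow> 'e \<Rightarrow> real"
  assumes "finite \<Phi>" "finite K" "card \<Phi> < card K"
  shows "\<exists>y. (\<exists>k\<in>K. y k \<noteq> 0) \<and> (\<forall>\<phi>\<in>\<Phi>. (\<Sum>k\<in>K. y k * B k \<phi>) = 0)"
  using assms
proof (induction \<Phi> arbitrary: K B rule: finite_induct)
  case empty
  then show ?case by (intro exI[of _ "\<lambda>_. 1"]) (auto simp: card_gt_0_iff)
next
  case (insert \<phi>0 \<Phi>)
  show ?case
  proof (cases "\<forall>k\<in>K. B k \<phi>0 = 0")
    case True
    then show ?thesis using insert.IH[of K B] insert.prems insert.hyps by auto
  next
    case False
    then obtain k0 where k0: "k0 \<in> K" "B k0 \<phi>0 \<noteq> 0" by blast
    define K' where "K' = K - {k0}"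
    have K: "finite K'" "K = insert k0 K'" "k0 \<notin> K'" "card \<Phi> < card K'"
      using k0 insert.prems insert.hyps by (auto simp: K'_def)
    obtain y where y: "\<exists>k\<in>K'. y k \<noteq> 0"
      "\<forall>\<phi>\<in>\<Phi>. (\<Sum>k\<in>K'. y k * (B k \<phi> - B k \<phi>0 / B k0 \<phi>0 * B k0 \<phi>)) = 0"
      using insert.IH[OF K(1,4), of "\<lambda>k \<phi>. B k \<phi> - B k \<phi>0 / B k0 \<phi>0 * B k0 \<phi>"] by blast
    define r where "r = - (\<Sum>k\<in>K'. y k * B k \<phi>0) / B k0 \<phi>0"
    have upd: "(\<Sum>k\<in>K. (y(k0 := r)) k * B k \<phi>) = r * B k0 \<phi> + (\<Sum>k\<in>K'. y k * B k \<phi>)" for \<phi>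
    proof -
      have "(\<Sum>k\<in>K'. (y(k0 := r)) k * B k \<phi>) = (\<Sum>k\<in>K'. y k * B k \<phi>)"
        using K by (intro sum.cong) auto
      then show ?thesis using K by simp
    qed
    have "(\<Sum>k\<in>K'. y k * (B k \<phi> - B k \<phi>0 / B k0 \<phi>0 * B k0 \<phi>))
        = r * B k0 \<phi> + (\<Sum>k\<in>K'. y k * B k \<phi>)" for \<phi>
      by (simp add: r_def algebra_simps sum_subtractf sum_divide_distrib sum_distrib_left)
    then have "(\<Sum>k\<in>K. (y(k0 := r)) k * B k \<phi>) = 0" if "\<phi> \<in> \<Phi>" for \<phi>
      using y(2) that by (simp add: upd del: fun_upd_apply)
    moreover have "(\<Sum>k\<in>K. (y(k0 := r)) k * B k \<phi>0) = 0"
      unfolding upd using k0 by (simp add: r_def)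
    moreover have "\<exists>k\<in>K. (y(k0 := r)) k \<noteq> 0"
      using y(1) K by auto
    ultimately show ?thesis by blast
  qed
qed

text \<open>
  Fewer linear conditions than linearly independent functions \<open>\<psi> k\<close> cannot force all \<open>\<psi> k\<close> to be
  annihilated: otherwise each \<open>\<psi> k\<close> would lie in the span of \<open>\<Phi>\<close>, whose dimension is too small.
\<close>

lemma separating_weighted_eval:
  assumes "finite \<Phi>" "finite K" "card \<Phi> < card K"
    and indep: "\<And>y. (\<And>x. (\<Sum>k\<in>K. y k * \<psi> k x) = 0) \<Longrightarrow> (\<forall>k\<in>K. y k = 0)"
  shows "\<exists>xs. (\<forall>\<phi>\<in>\<Phi>. weighted_eval xs \<phi> = 0) \<and> (\<exists>k\<in>K. weighted_eval xs (\<psi> k) \<noteq> 0)"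
proof (rule ccontr)
  assume *: "\<not> ?thesis"
  have "\<exists>B. \<forall>x. \<psi> k x = (\<Sum>\<phi>\<in>\<Phi>. B \<phi> * \<phi> x)" if "k \<in> K" for k
    by (rule linear_combination_of_annihilated[OF assms(1)]) (use * that in blast)
  then obtain B where B: "\<And>k x. k \<in> K \<Longrightarrow> \<psi> k x = (\<Sum>\<phi>\<in>\<Phi>. B k \<phi> * \<phi> x)"
    by metis
  obtain y where y: "\<exists>k\<in>K. y k \<noteq> 0" "\<forall>\<phi>\<in>\<Phi>. (\<Sum>k\<in>K. y k * B k \<phi>) = 0"
    using underdetermined_system[OF assms(1-3), of B] by blast
  have "(\<Sum>k\<in>K. y k * \<psi> k x) = 0" for x
  proof -
    have "(\<Sum>k\<in>K. y k * \<psi> k x) = (\<Sum>k\<in>K. \<Sum>\<phi>\<in>\<Phi>. y k * B k \<phi> * \<phi> x)"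
      by (intro sum.cong) (simp_all add: B sum_distrib_left mult.assoc)
    also have "\<dots> = (\<Sum>\<phi>\<in>\<Phi>. (\<Sum>k\<in>K. y k * B k \<phi>) * \<phi> x)"
      by (subst sum.swap) (simp add: sum_distrib_right)
    finally show ?thesis using y(2) by simp
  qed
  then show False using indep y(1) by blast
qed

text \<open>
  This is the invertibility of the Vandermonde matrix. The hypothesis extends to all polynomials of
  degree at most \<open>l\<close> in place of the powers, and the one that vanishes on \<open>K\<close> except at \<open>\<tau>0\<close> isolates
  \<open>y \<tau>0\<close>.
\<close>

lemma moments_zero_imp_zero:
  fixes K :: "real set" and y :: "real \<Rightarrow> real"
  assumes "finite K" "card K \<le> Suc l" "\<And>j. j \<le> l \<Longrightarrow> (\<Sum>\<tau>\<in>K. y \<tau> * \<tau> ^ j) = 0" "\<tau>0 \<in> K"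
  shows "y \<tau>0 = 0"
proof -
  define p where "p = (\<Prod>\<tau>\<in>K - {\<tau>0}. [:- \<tau>, 1:])"
  have "degree p \<le> (\<Sum>\<tau>\<in>K - {\<tau>0}. degree [:- \<tau>, 1:])"
    unfolding p_def using degree_prod_sum_le[of "K - {\<tau>0}" "\<lambda>\<tau>. [:- \<tau>, 1:]"] assms(1) by (simp add: o_def)
  then have deg: "degree p \<le> l" using assms by simp
  have "(\<Sum>\<tau>\<in>K. y \<tau> * poly p \<tau>) = (\<Sum>\<tau>\<in>K. \<Sum>j\<le>degree p. coeff p j * (y \<tau> * \<tau> ^ j))"
    by (simp add: poly_altdef sum_distrib_left mult_ac)
  also have "\<dots> = (\<Sum>j\<le>degree p. coeff p j * (\<Sum>\<tau>\<in>K. y \<tau> * \<tau> ^ j))"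
    by (subst sum.swap) (simp add: sum_distrib_left)
  also have "\<dots> = 0" using assms(3) deg by simp
  also have "(\<Sum>\<tau>\<in>K. y \<tau> * poly p \<tau>) = (\<Sum>\<tau>\<in>K. if \<tau> = \<tau>0 then y \<tau> * poly p \<tau> else 0)"
    using assms(1) by (intro sum.cong) (auto simp: p_def poly_prod prod_zero_iff)
  also have "\<dots> = y \<tau>0 * poly p \<tau>0" using assms by simp
  finally show ?thesis using assms(1) by (auto simp: p_def poly_prod)
qed

text \<open>
  Differentiating the relation \<open>j\<close> times with respect to \<open>w\<close> multiplies each term by \<open>\<tau>\<^sup>j\<close>; at \<open>w = 0\<close>
  the factor \<open>(deriv ^^ j) \<sigma> s\<close> is common to all terms and can be cancelled.
\<close>

lemma dilates_independent:
  fixes \<sigma> :: "real \<Rightarrow> real"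
  assumes \<sigma>: "Ck_on l \<sigma> UNIV" and s: "\<And>k. k \<le> l \<Longrightarrow> (deriv ^^ k) \<sigma> s \<noteq> 0"
    and K: "finite K" "card K \<le> Suc l"
    and zero: "\<And>w. (\<Sum>\<tau>\<in>K. y \<tau> * \<sigma> (w * \<tau> + s)) = 0"
  shows "\<forall>\<tau>\<in>K. y \<tau> = 0"
proof -
  have diff: "(\<Sum>\<tau>\<in>K. y \<tau> * \<tau> ^ j * (deriv ^^ j) \<sigma> (w * \<tau> + s)) = 0" if "j \<le> l" for j w
    using that
  proof (induction j arbitrary: w)
    case (Suc j)
    have "Ck_on (Suc (l - Suc j)) ((deriv ^^ j) \<sigma>) UNIV"
      using Ck_on_iterated_deriv[OF \<sigma>, of j] Suc.prems by (simp add: Suc_diff_Suc)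
    note [derivative_intros] = DERIV_chain2[OF Ck_on_Suc_real(1)[OF this]]
    have "((\<lambda>w. \<Sum>\<tau>\<in>K. y \<tau> * \<tau> ^ j * (deriv ^^ j) \<sigma> (w * \<tau> + s)) has_real_derivative
        (\<Sum>\<tau>\<in>K. y \<tau> * \<tau> ^ Suc j * (deriv ^^ Suc j) \<sigma> (w * \<tau> + s))) (at w)"
      by (auto intro!: derivative_eq_intros sum.cong simp: mult_ac)
    moreover have "((\<lambda>w. \<Sum>\<tau>\<in>K. y \<tau> * \<tau> ^ j * (deriv ^^ j) \<sigma> (w * \<tau> + s)) has_real_derivative 0) (at w)"
      using Suc by simp
    ultimately show ?case by (rule DERIV_unique)
  qed (use zero in simp)
  have "(\<Sum>\<tau>\<in>K. y \<tau> * \<tau> ^ j) = 0" if "j \<le> l" for j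
    using diff[OF that, of 0] s[OF that] by (simp flip: sum_distrib_right)
  then show ?thesis using moments_zero_imp_zero[OF K] by blast
qed

text \<open>
  The conditions on the unknown combination \<open>g t = \<Sum> c \<sigma> (w t + s)\<close> are read as functions of the
  weight \<open>w\<close>: the value of \<open>g\<close> at \<open>t\<close> evaluates \<open>w \<mapsto> \<sigma> (w t + s)\<close>, and its derivative evaluates
  \<open>w \<mapsto> w \<sigma>' (w t + s)\<close>. There are at most \<open>l\<close> of them, against \<open>l + 1\<close> independent functions that
  belong to points of \<open>T\<close>.
\<close>

lemma vanishing_combination:
  fixes \<sigma> :: "real \<Rightarrow> real"
  assumes \<sigma>: "Ck_on l \<sigma> UNIV" and s: "\<And>k. k \<le> l \<Longrightarrow> (deriv ^^ k) \<sigma> s \<noteq> 0"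
    and P: "finite P" "finite Q" "card P + card Q \<le> l" and T: "infinite T"
  obtains xs \<tau> where "\<And>t. t \<in> P \<Longrightarrow> (\<Sum>(c, w)\<leftarrow>xs. c * \<sigma> (w * t + s)) = 0"
    "\<And>t. t \<in> Q \<Longrightarrow> (\<Sum>(c, w)\<leftarrow>xs. c * (w * deriv \<sigma> (w * t + s))) = 0"
    "\<tau> \<in> T" "(\<Sum>(c, w)\<leftarrow>xs. c * \<sigma> (w * \<tau> + s)) \<noteq> 0"
proof -
  obtain K where K: "K \<subseteq> T" "finite K" "card K = Suc l"
    using infinite_arbitrarily_large[OF T] by blast
  define \<Phi> where
    "\<Phi> = (\<lambda>t w. \<sigma> (w * t + s)) ` P \<union> (\<lambda>t w. w * deriv \<sigma> (w * t + s)) ` Q"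
  have "finite \<Phi>" using P by (simp add: \<Phi>_def)
  have "card \<Phi> \<le> card P + card Q"
    unfolding \<Phi>_def by (intro order.trans[OF card_Un_le] add_mono card_image_le P)
  then have "card \<Phi> < card K" using P K by simp
  moreover have "\<forall>\<tau>\<in>K. y \<tau> = 0" if "\<And>w. (\<Sum>\<tau>\<in>K. y \<tau> * \<sigma> (w * \<tau> + s)) = 0" for y
    using dilates_independent[OF \<sigma> s K(2) _ that] K(3) by simp
  ultimately obtain xs \<tau> where "\<And>\<phi>. \<phi> \<in> \<Phi> \<Longrightarrow> weighted_eval xs \<phi> = 0" "\<tau> \<in> K"
      "weighted_eval xs (\<lambda>w. \<sigma> (w * \<tau> + s)) \<noteq> 0"
    using separating_weighted_eval[OF \<open>finite \<Phi>\<close> K(2), of "\<lambda>\<tau> w. \<sigma> (w * \<tau> + s)"] by metis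
  then show thesis using K(1)
    by (intro that[of xs \<tau>]) (auto simp: weighted_eval_def \<Phi>_def)
qed

section \<open>Networks that the loss does not detect\<close>

text \<open>
  Adding or subtracting \<open>q\<close> turns a gradient of one function into a gradient of the other, so the two
  descriptions that define \<open>gradient u z\<close> and \<open>gradient u' z\<close> have the same solutions, if any. The condition on a neighbourhood allows for functions restricted to a closed set.
\<close>

lemma gradient_cong_add_critical:
  fixes u u' q :: "'a::real_inner \<Rightarrow> real"
  assumes S: "open S" "z \<in> S" and sum: "\<And>x. x \<in> S \<Longrightarrow> u' x = u x + q x"
    and q: "(q has_derivative (\<lambda>_. 0)) (at z)"
  shows "gradient u' z = gradient u z"
proof -
  have "GDERIV u' z :> D \<longleftrightarrow> GDERIV u z :> D" for D
  proof
    assume "GDERIV u' z :> D"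
    then have "((\<lambda>x. u' x - q x) has_derivative (\<lambda>h. inner h D)) (at z)"
      using has_derivative_diff[OF _ q] by (fastforce simp: gderiv_def)
    then show "GDERIV u z :> D" unfolding gderiv_def
      by (rule has_derivative_transform_within_open[OF _ S]) (simp add: sum)
  next
    assume "GDERIV u z :> D"
    then have "((\<lambda>x. u x + q x) has_derivative (\<lambda>h. inner h D)) (at z)"
      using has_derivative_add[OF _ q] by (fastforce simp: gderiv_def)
    then show "GDERIV u' z :> D" unfolding gderiv_def
      by (rule has_derivative_transform_within_open[OF _ S]) (simp add: sum)
  qed
  then show ?thesis by (simp add: gradient_def)
qed

lemma infinite_minimizers_if_undetected_network:
  fixes \<Omega> \<Omega>h \<Gamma>h :: "(real ^ 'd::finite) set" and p \<alpha> :: real and \<L> \<B> \<omega>\<^sub>L \<omega>\<^sub>B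
  defines "J \<equiv> deep_ritz_loss \<L> \<B> p \<alpha> \<omega>\<^sub>L \<omega>\<^sub>B \<Omega>h \<Gamma>h"
  assumes u: "is_arg_min J (\<lambda>u. u \<in> network_class_sm \<sigma> L \<Omega> r (\<Omega>h \<union> \<Gamma>h)) u"
    and "2 \<le> L" "open \<Omega>" "\<Omega>h \<subseteq> \<Omega>" "\<Gamma>h \<subseteq> closure \<Omega>"
    and v: "v \<in> networks \<sigma> L" "\<And>z. z \<in> \<Omega>h \<union> \<Gamma>h \<Longrightarrow> Ck_at r v z"
    and v_zero: "\<And>z. z \<in> \<Omega>h \<union> \<Gamma>h \<Longrightarrow> v z = 0"
    and v_crit: "\<And>z. z \<in> \<Omega>h \<Longrightarrow> (v has_derivative (\<lambda>_. 0)) (at z)"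
    and x0: "x0 \<in> closure \<Omega>" "v x0 \<noteq> 0"
  shows "infinite {u. is_arg_min J (\<lambda>u. u \<in> network_class_sm \<sigma> L \<Omega> r (\<Omega>h \<union> \<Gamma>h)) u}"
proof -
  obtain f where f: "u = restrict f (closure \<Omega>)" "f \<in> networks \<sigma> L" "\<forall>z\<in>\<Omega>h \<union> \<Gamma>h. Ck_at r f z"
    using u by (auto simp: is_arg_min_def network_class_sm_def)
  define w where "w t = restrict (\<lambda>x. f x + t * v x) (closure \<Omega>)" for t
  have "w t \<in> network_class_sm \<sigma> L \<Omega> r (\<Omega>h \<union> \<Gamma>h)" for t
    unfolding network_class_sm_def w_def
    using networks_add_cmult[OF f(2) v(1) \<open>2 \<le> L\<close>, of t] f(3) v(2)
    by (auto intro!: Ck_at_add Ck_at_cmult)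
  moreover have "J (w t) = J u" for t
  proof -
    have "gradient (w t) z = gradient u z" if "z \<in> \<Omega>h" for z
    proof (rule gradient_cong_add_critical[OF \<open>open \<Omega>\<close>])
      show "z \<in> \<Omega>" using that \<open>\<Omega>h \<subseteq> \<Omega>\<close> by auto
      show "w t x = u x + t * v x" if "x \<in> \<Omega>" for x
        using that closure_subset by (auto simp: w_def f(1))
      show "((\<lambda>x. t * v x) has_derivative (\<lambda>_. 0)) (at z)"
        using has_derivative_mult_right[OF v_crit[OF \<open>z \<in> \<Omega>h\<close>], of t] by simp
    qed
    moreover have "w t z = u z" if "z \<in> \<Omega>h \<union> \<Gamma>h" for z
      using that by (simp add: w_def f(1) v_zero restrict_def)
    ultimately show ?thesis by (simp add: J_def deep_ritz_loss_def)
  qed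
  ultimately have "range w \<subseteq> {u. is_arg_min J (\<lambda>u. u \<in> network_class_sm \<sigma> L \<Omega> r (\<Omega>h \<union> \<Gamma>h)) u}"
    using u by (auto simp: is_arg_min_def)
  moreover have "inj w"
  proof (rule injI)
    fix t t' assume "w t = w t'"
    then have "w t x0 = w t' x0" by simp
    then show "t = t'" using x0 by (simp add: w_def)
  qed
  then have "infinite (range w)" by (simp add: finite_image_iff infinite_UNIV_char_0)
  ultimately show ?thesis using infinite_super by blast
qed

text \<open>
  An open set contains a segment in every coordinate direction. So one coordinate suffices to find
  points of \<open>\<Omega>\<close> that differ from finitely many given ones.
\<close>

lemma infinite_coordinates:
  fixes \<Omega> :: "(real ^ 'd::finite) set"
  assumes "open \<Omega>" "\<Omega> \<noteq> {}"
  shows "infinite ((\<lambda>x. x $ i) ` \<Omega>)"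
proof -
  obtain x r where x: "r > 0" "ball x r \<subseteq> \<Omega>"
    using assms by (meson all_not_in_conv openE)
  have "{x $ i <..< x $ i + r} \<subseteq> (\<lambda>x. x $ i) ` \<Omega>"
  proof
    fix y assume y: "y \<in> {x $ i <..< x $ i + r}"
    define z where "z = x + (y - x $ i) *\<^sub>R axis i 1"
    have "dist x z < r" using y by (simp add: z_def dist_norm)
    then have "z \<in> \<Omega>" using x by auto
    moreover have "z $ i = y" by (simp add: z_def)
    ultimately show "y \<in> (\<lambda>x. x $ i) ` \<Omega>" by force
  qed
  moreover have "infinite {x $ i <..< x $ i + r}" using x(1) by (intro infinite_Ioo) simp
  ultimately show ?thesis by (rule infinite_super)
qed

lemma relu_tower:
  assumes "0 \<le> \<beta>" "0 \<le> y + \<beta>"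
  shows "((\<lambda>y. relu (y + \<beta>)) ^^ n) y = y + real n * \<beta>"
proof (induction n)
  case (Suc n)
  have "0 \<le> y + \<beta> + real n * \<beta>" using assms by simp
  then show ?case using Suc by (simp add: relu_def algebra_simps)
qed simp

text \<open>
  The hat function of height \<open>e\<close> on \<open>[m - e, m + e]\<close> is the second difference
  \<open>relu (t - m + e) - 2 relu (t - m) + relu (t - m - e)\<close>. Its centre \<open>m\<close> is the coordinate of a point
  of \<open>\<Omega>\<close>, at distance \<open>d\<close> or more from the coordinates of all points of \<open>Z\<close>. As points of \<open>Z\<close> may lie
  on the boundary, \<open>v\<close> is described on a neighbourhood \<open>U\<close> that is not contained in the closure of \<open>\<Omega>\<close>.
\<close>

lemma undetected_relu_network:
  fixes \<Omega> Z :: "(real ^ 'd::finite) set"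
  assumes "open \<Omega>" "\<Omega> \<noteq> {}" "bounded \<Omega>" "finite Z" "Z \<subseteq> closure \<Omega>" "2 \<le> L"
  obtains v U x0 where "v \<in> networks relu L" "open U" "Z \<subseteq> U" "\<And>x. x \<in> U \<Longrightarrow> v x = 0"
    "x0 \<in> \<Omega>" "v x0 \<noteq> 0"
proof -
  define i :: 'd where "i = from_nat_into UNIV 0"
  obtain R where R: "\<And>x. x \<in> closure \<Omega> \<Longrightarrow> norm x \<le> R" "0 < R"
    using assms(3) by (meson bounded_closure bounded_pos)
  obtain x0 where x0: "x0 \<in> \<Omega>" "x0 $ i \<notin> (\<lambda>x. x $ i) ` Z"
    using infinite_coordinates[OF assms(1,2), of i] assms(4)
    by (metis (no_types, lifting) finite_imageI finite_subset image_subsetI)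
  define m where "m = x0 $ i"
  obtain d where d: "d > 0" "\<And>z. z \<in> Z \<Longrightarrow> d \<le> \<bar>z $ i - m\<bar>"
    using finite_set_avoid[of "(\<lambda>x. x $ i) ` Z" m] assms(4) x0
    by (fastforce simp: m_def dist_real_def)
  \<comment> \<open>With \<open>e < d\<close> the support of the hat stays away from \<open>Z\<close>. With \<open>\<beta> > R\<close> the activations of the
    narrow layers are the identity near the closure of \<open>\<Omega>\<close>, where these layers together shift
    the coordinate by \<open>off\<close>.\<close>
  define e \<beta> where "e = d / 2" and "\<beta> = R + 1"
  define off where "off = real (L - 2) * \<beta>"
  define xs :: "(real \<times> real \<times> real) list"
    where "xs = [(1, 1, e - m - off), (- 2, 1, - m - off), (1, 1, - e - m - off)]"
  define v where "v x = (\<Sum>(c, w, a)\<leftarrow>xs.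
      c * relu (w * ((\<lambda>y. relu (y + \<beta>)) ^^ (L - 2)) (x $ i) + a))" for x :: "real^'d"
  define U where "U = {x :: real^'d. 0 < x $ i + \<beta>} \<inter> {x. e < \<bar>x $ i - m\<bar>}"
  have v: "v x = relu (x $ i - m + e) - 2 * relu (x $ i - m) + relu (x $ i - m - e)"
    if "0 \<le> x $ i + \<beta>" for x
    using relu_tower[of \<beta> "x $ i" "L - 2"] that R(2)
    by (simp add: v_def xs_def off_def \<beta>_def algebra_simps)
  have pos: "0 < x $ i + \<beta>" if "x \<in> closure \<Omega>" for x
    using R(1)[OF that] component_le_norm_cart[of x i] by (simp add: \<beta>_def)
  show thesis
  proof
    show "v \<in> networks relu L"
      using ridge_network[OF assms(6), of xs relu \<beta>] by (simp add: v_def[abs_def] xs_def i_def)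
    show "open U"
      unfolding U_def by (intro open_Int open_Collect_less continuous_intros)
    show "Z \<subseteq> U"
      using assms(5) pos d by (force simp: U_def e_def)
    show "v x = 0" if "x \<in> U" for x
    proof -
      have "0 \<le> x $ i + \<beta>" "e < \<bar>x $ i - m\<bar>" using that by (auto simp: U_def)
      then show ?thesis using v[of x] d(1) by (auto simp: relu_def e_def max_def abs_if split: if_splits)
    qed
    show "x0 \<in> \<Omega>" by fact
    have "x0 \<in> closure \<Omega>" using x0(1) closure_subset by auto
    then have "v x0 = e" using v[of x0] pos d(1) by (simp add: m_def relu_def e_def less_imp_le)
    then show "v x0 \<noteq> 0" using d(1) by (simp add: e_def)
  qed
qed

text \<open>
  The sample points may collide under \<open>\<rho>\<close>; this only lowers the number of conditions on \<open>g\<close>. That \<open>\<rho>\<close>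
  takes infinitely many values on \<open>\<Omega>\<close> provides the points at which \<open>g\<close> may be nonzero, and for this
  the activation has to be injective as soon as it is iterated in \<open>\<rho>\<close>.
\<close>

lemma undetected_smooth_network:
  fixes \<Omega> \<Omega>h \<Gamma>h :: "(real ^ 'd::finite) set" and \<sigma> :: "real \<Rightarrow> real"
  assumes "open \<Omega>" "\<Omega> \<noteq> {}" "finite \<Omega>h" "finite \<Gamma>h" "2 \<le> L"
    and \<sigma>: "Ck_on (2 * card \<Omega>h + card \<Gamma>h) \<sigma> UNIV"
    and s: "\<And>k. k \<le> 2 * card \<Omega>h + card \<Gamma>h \<Longrightarrow> (deriv ^^ k) \<sigma> s \<noteq> 0"
    and inj: "L > 2 \<Longrightarrow> inj \<sigma>"
  obtains v x0 where "v \<in> networks \<sigma> L" "\<And>z. z \<in> \<Omega>h \<union> \<Gamma>h \<Longrightarrow> v z = 0"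
    "\<And>z. z \<in> \<Omega>h \<Longrightarrow> (v has_derivative (\<lambda>_. 0)) (at z)" "x0 \<in> \<Omega>" "v x0 \<noteq> 0"
proof -
  define l where "l = 2 * card \<Omega>h + card \<Gamma>h"
  define i :: 'd where "i = from_nat_into UNIV 0"
  define \<rho> where "\<rho> x = (\<sigma> ^^ (L - 2)) (x $ i)" for x :: "real^'d"
  have "inj (\<sigma> ^^ (L - 2))"
    using inj assms(5) by (cases "L > 2") (auto intro: inj_fn)
  then have "infinite ((\<sigma> ^^ (L - 2)) ` (\<lambda>x. x $ i) ` \<Omega>)"
    using infinite_coordinates[OF assms(1,2), of i] by (meson finite_imageD inj_on_subset subset_UNIV)
  then have T: "infinite (\<rho> ` \<Omega>)" by (simp add: \<rho>_def[abs_def] image_image)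
  have "card (\<rho> ` (\<Omega>h \<union> \<Gamma>h)) + card (\<rho> ` \<Omega>h) \<le> card (\<Omega>h \<union> \<Gamma>h) + card \<Omega>h"
    using assms(3,4) by (intro add_mono card_image_le) auto
  also have "\<dots> \<le> l" using card_Un_le[of \<Omega>h \<Gamma>h] by (simp add: l_def)
  finally have card: "card (\<rho> ` (\<Omega>h \<union> \<Gamma>h)) + card (\<rho> ` \<Omega>h) \<le> l" .
  obtain xs \<tau> where
    zero: "\<And>t. t \<in> \<rho> ` (\<Omega>h \<union> \<Gamma>h) \<Longrightarrow> (\<Sum>(c, w)\<leftarrow>xs. c * \<sigma> (w * t + s)) = 0"
    and crit: "\<And>t. t \<in> \<rho> ` \<Omega>h \<Longrightarrow> (\<Sum>(c, w)\<leftarrow>xs. c * (w * deriv \<sigma> (w * t + s))) = 0"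
    and \<tau>: "\<tau> \<in> \<rho> ` \<Omega>" "(\<Sum>(c, w)\<leftarrow>xs. c * \<sigma> (w * \<tau> + s)) \<noteq> 0"
    using vanishing_combination[OF \<sigma> s _ _ card[unfolded l_def] T] assms(3,4) by blast
  define g where "g t = (\<Sum>(c, w)\<leftarrow>xs. c * \<sigma> (w * t + s))" for t
    obtain x0 where x0: "x0 \<in> \<Omega>" "\<tau> = \<rho> x0" using \<tau>(1) by blast
  show thesis
  proof
    show "(\<lambda>x. g (\<rho> x)) \<in> networks \<sigma> L"
    proof -
      have "xs \<noteq> []" using \<tau>(2) by auto
      then have "(\<lambda>x. \<Sum>(c, w, a)\<leftarrow>map (\<lambda>(c, w). (c, w, s)) xs.
            c * \<sigma> (w * ((\<lambda>y. \<sigma> (y + 0)) ^^ (L - 2)) (x $ i) + a)) \<in> networks \<sigma> L"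
        unfolding i_def by (intro ridge_network[OF assms(5)]) simp
      then show ?thesis by (simp add: g_def \<rho>_def o_def case_prod_unfold)
    qed
    show "g (\<rho> z) = 0" if "z \<in> \<Omega>h \<union> \<Gamma>h" for z
      unfolding g_def by (rule zero[OF imageI[OF that]])
    show "((\<lambda>x. g (\<rho> x)) has_derivative (\<lambda>_. 0)) (at z)" if z: "z \<in> \<Omega>h" for z
    proof -
      have "0 < card \<Omega>h" using z assms(3) card_gt_0_iff by blast
      \<comment> \<open>A point of \<open>\<Omega>h\<close> contributes to \<open>l\<close>, so \<open>\<sigma>\<close> is at least once differentiable.\<close>
      then obtain l' where l': "l = Suc l'" unfolding l_def by (cases "card \<Omega>h") auto
      have \<sigma>l: "Ck_on (Suc l') \<sigma> UNIV" using \<sigma> by (simp add: l'[symmetric] l_def)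
      have "Ck_on (Suc l') (\<lambda>x::real^'d. (\<sigma> ^^ n) (x $ i)) UNIV" for n
      proof (induction n)
        case 0
        show ?case using Ck_on_bounded_linear[OF bounded_linear_vec_nth, of "Suc l'" i UNIV] by simp
      next
        case (Suc n)
        from Ck_on_compose_real[OF open_UNIV \<sigma>l this] show ?case by simp
      qed
      then have \<rho>: "(\<rho> has_derivative frechet_derivative \<rho> (at z)) (at z)"
        by (intro Ck_on_Suc_D[of l' \<rho> UNIV]) (simp_all add: \<rho>_def[abs_def])
      note D = DERIV_chain2[OF Ck_on_Suc_real(1)[OF \<sigma>l]]
      have "((\<lambda>t. \<Sum>(c, w)\<leftarrow>ys. c * \<sigma> (w * t + s)) has_real_derivative
            (\<Sum>(c, w)\<leftarrow>ys. c * (w * deriv \<sigma> (w * t + s)))) (at t)" for ys t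
      proof (induction ys)
        case (Cons y ys)
        have "((\<lambda>t. fst y * \<sigma> (snd y * t + s)) has_real_derivative
            fst y * (snd y * deriv \<sigma> (snd y * t + s))) (at t)"
          by (auto intro!: derivative_eq_intros D)
        from DERIV_add[OF this Cons] show ?case by (simp add: case_prod_beta)
      qed simp
      from this[of xs "\<rho> z"] have "(g has_real_derivative 0) (at (\<rho> z))"
        using crit[OF imageI[OF z]] by (simp add: g_def[abs_def])
      from has_derivative_compose[OF \<rho> this[unfolded has_field_derivative_def]]
      show ?thesis by simp
    qed
    show "x0 \<in> \<Omega>" by fact
    show "g (\<rho> x0) \<noteq> 0" using x0 \<tau>(2) by (simp add: g_def)
  qed
qed

theorem theorem3p3:
  fixes \<Omega> \<Gamma> \<Omega>h \<Gamma>h Zh :: "(real ^ 'd::finite) set"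
    and \<L> :: "real ^ 'd \<Rightarrow> real \<Rightarrow> real ^ 'd \<Rightarrow> real"
    and \<B> :: "real ^ 'd \<Rightarrow> real \<Rightarrow> real"
    and p \<alpha> :: real
    and \<omega>\<^sub>L \<omega>\<^sub>B :: "real ^ 'd \<Rightarrow> real"
    and \<sigma> :: "real \<Rightarrow> real"
    and L l :: nat
    and H :: "(real ^ 'd \<Rightarrow> real) set"
  assumes "bounded_lipschitz_domain \<Omega>"
    and "\<Gamma> \<subseteq> frontier \<Omega>" and "surface_measurable \<Gamma>"
    and "finite \<Omega>h" and "\<Omega>h \<subseteq> \<Omega>"
    and "finite \<Gamma>h" and "\<Gamma>h \<subseteq> \<Gamma>"
    and "Zh = \<Omega>h \<union> \<Gamma>h" and "Zh \<noteq> {}"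
    and "1 \<le> p" and "0 \<le> \<alpha>"
    and "l = 2 * card \<Omega>h + card \<Gamma>h"
    and "(\<sigma> = relu \<and> int L \<ge> \<lceil>log 2 (real CARD('d) + 1)\<rceil> + 1
            \<and> H = network_class_sm \<sigma> L \<Omega> 1 Zh)
       \<or> (Ck_on l \<sigma> UNIV \<and> (\<exists>s. \<forall>k\<le>l. (deriv ^^ k) \<sigma> s \<noteq> 0)
            \<and> L \<ge> 2 \<and> (L > 2 \<longrightarrow> strict_mono \<sigma> \<or> strict_antimono_on UNIV \<sigma>)
            \<and> H = network_class_sm \<sigma> L \<Omega> l Zh)"
    and "\<exists>u. is_arg_min (deep_ritz_loss \<L> \<B> p \<alpha> \<omega>\<^sub>L \<omega>\<^sub>B \<Omega>h \<Gamma>h) (\<lambda>u. u \<in> H) u"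
  shows "infinite {u. is_arg_min (deep_ritz_loss \<L> \<B> p \<alpha> \<omega>\<^sub>L \<omega>\<^sub>B \<Omega>h \<Gamma>h) (\<lambda>u. u \<in> H) u}"
proof -
  have \<Omega>: "open \<Omega>" "\<Omega> \<noteq> {}" "bounded \<Omega>"
    using assms(1) by (auto simp: bounded_lipschitz_domain_def)
  have \<Gamma>h: "\<Gamma>h \<subseteq> closure \<Omega>" using assms(2,7) by (auto simp: frontier_def)
  obtain u where u: "is_arg_min (deep_ritz_loss \<L> \<B> p \<alpha> \<omega>\<^sub>L \<omega>\<^sub>B \<Omega>h \<Gamma>h) (\<lambda>u. u \<in> H) u"
    using assms(14) by blast
  from assms(13) show ?thesis
  proof (elim disjE conjE exE)
    assume relu: "\<sigma> = relu" and depth: "int L \<ge> \<lceil>log 2 (real CARD('d) + 1)\<rceil> + 1"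
      and H: "H = network_class_sm \<sigma> L \<Omega> 1 Zh"
    \<comment> \<open>The depth bound provides a hidden layer, as its logarithm is positive.\<close>
    have "0 < log 2 (real CARD('d) + 1)" by (simp add: zero_less_log_cancel_iff)
    then have L: "2 \<le> L" using depth by linarith
    have "finite Zh" "Zh \<subseteq> closure \<Omega>"
      using assms(4-8) \<Gamma>h closure_subset[of \<Omega>] by auto
    from undetected_relu_network[OF \<Omega> this L]
    obtain v U x0 where v: "v \<in> networks relu L" and U: "open U" "Zh \<subseteq> U" "\<And>x. x \<in> U \<Longrightarrow> v x = 0"
      and x0: "x0 \<in> \<Omega>" "v x0 \<noteq> 0"
      by metis
    have x0_closure: "x0 \<in> closure \<Omega>" using x0(1) closure_subset by blast
    have "(v has_derivative (\<lambda>_. 0)) (at z)" if "z \<in> \<Omega>h" for z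
    proof (rule has_derivative_transform_within_open[OF has_derivative_const[where c = 0] U(1)])
      show "z \<in> U" using that U(2) assms(8) by blast
      show "0 = v x" if "x \<in> U" for x using U(3)[OF that] by simp
    qed
    moreover have "Ck_at 1 v z" if "z \<in> \<Omega>h \<union> \<Gamma>h" for z
    proof (rule Ck_at_locally_zero[OF U(1) _ U(3)])
      show "z \<in> U" using that U(2) assms(8) by blast
    qed
    moreover have "v z = 0" if "z \<in> \<Omega>h \<union> \<Gamma>h" for z
    proof (rule U(3))
      show "z \<in> U" using that U(2) assms(8) by blast
    qed
    ultimately show ?thesis
      unfolding H assms(8) relu
      by (intro infinite_minimizers_if_undetected_network[OF u[unfolded H assms(8) relu]
          L \<Omega>(1) assms(5) \<Gamma>h v _ _ _ x0_closure x0(2)])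
  next
    fix s
    assume \<sigma>: "Ck_on l \<sigma> UNIV" and s: "\<forall>k\<le>l. (deriv ^^ k) \<sigma> s \<noteq> 0" and L: "L \<ge> 2"
      and mono: "L > 2 \<longrightarrow> strict_mono \<sigma> \<or> strict_antimono_on UNIV \<sigma>"
      and H: "H = network_class_sm \<sigma> L \<Omega> l Zh"
    have "inj \<sigma>" if "L > 2"
    proof (rule linorder_injI)
      fix x y :: real assume "x < y"
      then show "\<sigma> x \<noteq> \<sigma> y" using mono that by (fastforce simp: strict_mono_def monotone_on_def)
    qed
    then obtain v x0 where v: "v \<in> networks \<sigma> L" "\<And>z. z \<in> \<Omega>h \<union> \<Gamma>h \<Longrightarrow> v z = 0"
      "\<And>z. z \<in> \<Omega>h \<Longrightarrow> (v has_derivative (\<lambda>_. 0)) (at z)" and x0: "x0 \<in> \<Omega>" "v x0 \<noteq> 0"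
      using undetected_smooth_network[OF \<Omega>(1,2) assms(4,6) L, of \<sigma> s] \<sigma> s assms(12) by metis
    have x0_closure: "x0 \<in> closure \<Omega>" using x0(1) closure_subset by blast
    have "Ck_at l v z" for z
      using networks_Ck_on[OF \<sigma> v(1)] unfolding Ck_at_def by blast
    then show ?thesis
      unfolding H assms(8)
      by (intro infinite_minimizers_if_undetected_network[OF u[unfolded H assms(8)]
          L \<Omega>(1) assms(5) \<Gamma>h v(1) _ v(2,3) x0_closure x0(2)])
  qed
qed

end
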